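(* Let $q$ be an odd prime power and $n$ a positive integer. If a set $A\subseteq \mathbb{F}_q^n$ does not contain a right angle, i.e. there are no three distinct vectors $x,y,z\in A$ with $\langle x-z,y-z\rangle=0$, then $$|A|\leq 4(q-1)q\binom{n+q-2}{q-2}+2q.$$
   Context: $\langle u,v\rangle=\sum_{i=1}^n u_iv_i$ denotes the standard dot product on $\mathbb{F}_q^n$. *)

theory Defs
  imports Complex_Main "HOL-Analysis.Finite_Cartesian_Product" "HOL-Number_Theory.Prime_Powers"
begin

text \<open>
  The form used is the library's \<open>scalar_product\<close> over an arbitrary field, not the real-valued
  \<open>inner\<close>. Over a finite field, nonzero vectors may be orthogonal to themselves, so distinctness
  of the three points, in particular of \<open>x\<close> and \<open>y\<close>, has to be demanded explicitly.
\<close>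

definition contains_right_angle :: "('a::field ^ 'n) set \<Rightarrow> bool" where
  "contains_right_angle A \<longleftrightarrow>
     (\<exists>x\<in>A. \<exists>y\<in>A. \<exists>z\<in>A. x \<noteq> y \<and> x \<noteq> z \<and> y \<noteq> z \<and> scalar_product (x - z) (y - z) = 0)"

end

(* Two applications of the polynomial method. Translate a point y of A to the origin. For distinct
   x, z in A - {y} with <z,z> = w, the absence of right angles at y and at z says that <x,z> is
   neither 0 nor w. If w is nonzero, the product of the q - 2 factors <x,z> - c over c other
   than 0 and w is thus zero for x different from z and nonzero for x = z, so at most
   (n+q-2 choose q-2) points share this value w of the norm <z,z>. The points with <z,z> = 0
   are handled by a change of base point: if y' is one of them, then any other such z has
   <z-y',z-y'> = -2<z,y'>, which is nonzero since q is odd. *)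
theory Submission
  imports Defs "HOL-Analysis.Cartesian_Space" "HOL-Library.Multiset"
begin

lemma scalar_product_diff_left:
  "scalar_product (x - y) z = scalar_product x z - scalar_product y (z :: 'a::comm_ring_1 ^ 'n)"
  by (simp add: scalar_product_def left_diff_distrib sum_subtractf)

lemma scalar_product_commute: "scalar_product x y = scalar_product y (x :: 'a::comm_ring_1 ^ 'n)"
  by (simp add: scalar_product_def mult.commute)

lemma scalar_product_diff_right:
  "scalar_product x (y - z) = scalar_product x y - scalar_product x (z :: 'a::comm_ring_1 ^ 'n)"
  by (metis scalar_product_commute scalar_product_diff_left)

text \<open>The shift by 1 permutes the field, so comparing sums over all elements gives
  \<open>of_nat CARD('a) = 0\<close>; if 2 were 0, odd cardinality would turn this into 1 =
  0.\<close>

lemma two_neq_zero_if_odd_card: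
  assumes "odd CARD('a::{field,finite})"
  shows "(2::'a) \<noteq> 0"
proof
  assume two: "(2::'a) = 0"
  have "(\<Sum>x::'a\<in>UNIV. x + 1) = (\<Sum>x\<in>UNIV. x)"
    by (rule sum.reindex_bij_witness[where i = "\<lambda>x. x - 1" and j = "\<lambda>x. x + 1"]) auto
  then have "of_nat CARD('a) = (0::'a)"
    by (simp add: sum.distrib)
  moreover obtain k where "CARD('a) = 2 * k + 1"
    using assms by (elim oddE)
  ultimately show False
    using two by simp
qed

text \<open>On the coordinates in \<open>B\<close> the vectors \<open>F x\<close> form a diagonal
  matrix with nonzero diagonal, so they are independent. A vector indexed by \<open>'b\<close>
  serves as the table of values of a function on \<open>'b\<close>.\<close>

lemma diagonal_card_le_of_span:
  fixes F :: "'b::finite \<Rightarrow> 'a::field ^ 'b"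
  assumes diag: "\<And>x. x \<in> B \<Longrightarrow> F x $ x \<noteq> 0"
    and off_diag: "\<And>x z. x \<in> B \<Longrightarrow> z \<in> B \<Longrightarrow> x \<noteq> z \<Longrightarrow> F x $ z = 0"
    and span: "F ` B \<subseteq> vec.span T" and "finite T"
  shows "card B \<le> card T"
proof -
  have inj: "inj_on F B"
    using diag off_diag by (metis inj_onI)
  have "vec.independent (F ` B)"
    unfolding vec.dependent_finite[OF finite_imageI[OF finite]]
  proof (clarsimp simp: sum.reindex[OF inj])
    fix u x
    assume sum0: "(\<Sum>x\<in>B. u (F x) *s F x) = 0" and x: "x \<in> B" and u: "u (F x) \<noteq> 0"
    \<comment> \<open>Coordinate \<open>x\<close> of the linear relation isolates the coefficient of
      \<open>F x\<close>.\<close>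
    have "(\<Sum>x\<in>B. u (F x) *s F x) $ x = (\<Sum>z\<in>B. u (F z) * F z $ x)"
      by simp
    also have "\<dots> = (\<Sum>z\<in>B. if z = x then u (F x) * F x $ x else 0)"
      using off_diag x by (intro sum.cong) auto
    also have "\<dots> = u (F x) * F x $ x"
      using x by simp
    finally show False
      using sum0 u diag[OF x] by simp
  qed
  from vec.independent_span_bound[OF \<open>finite T\<close> this span] show ?thesis
    by (simp add: card_image inj)
qed

text \<open>Expanding the product yields monomials of degree \<open>card K\<close> in the
  \<open>v i\<close>. By commutativity a monomial depends only on the multiset of its indices, which
  is what later makes the dimension bound a binomial coefficient.\<close>

lemma prod_linear_forms_in_span:
  fixes a :: "'k \<Rightarrow> 'i \<Rightarrow> 'a::field" and v :: "'i \<Rightarrow> 'b::finite \<Rightarrow> 'a"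
  assumes "finite K"
  shows "(\<chi> z. \<Prod>k\<in>K. \<Sum>i\<in>I. a k i * v i z) \<in>
    vec.span ((\<lambda>M. \<chi> z. \<Prod>i\<in>#M. v i z) ` multisets_of_size I (card K))"
  using assms
proof (induction K)
  case empty
  then show ?case
    by (intro vec.span_base, rule image_eqI[where x = "{#}"]) (simp_all add: multisets_of_size_def)
next
  case (insert k K)
  define mon where "mon = (\<lambda>M. \<chi> z. \<Prod>i\<in>#M. v i z)"
  define D where "D = (\<lambda>d. mon ` multisets_of_size I d)"
  \<comment> \<open>Multiplication by \<open>v i\<close> raises the degree by one; each new factor
    is a linear combination of such multiplications.\<close>
  have mult: "(\<chi> z. v i z * p $ z) \<in> vec.span (D (Suc d))"
    if "p \<in> vec.span (D d)" and i: "i \<in> I" for p d i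
    using that(1)
  proof (induction rule: vec.span_induct_alt)
    case base
    then show ?case
      using vec.span_zero by (simp add: zero_vec_def)
  next
    case (step c m p)
    then obtain M where M: "M \<in> multisets_of_size I d" and m: "m = mon M"
      by (auto simp: D_def)
    have "(\<chi> z. v i z * (c *s m + p) $ z) = c *s mon (add_mset i M) + (\<chi> z. v i z * p $ z)"
      by (simp add: vec_eq_iff m mon_def algebra_simps)
    moreover have "mon (add_mset i M) \<in> D (Suc d)"
      using M i by (auto simp: D_def multisets_of_size_def)
    ultimately show ?case
      using step by (simp add: vec.span_add vec.span_scale vec.span_base)
  qed
  have "(\<chi> z. \<Prod>k\<in>insert k K. \<Sum>i\<in>I. a k i * v i z) =
      (\<Sum>i\<in>I. a k i *s (\<chi> z. v i z * (\<chi> z. \<Prod>k\<in>K. \<Sum>i\<in>I. a k i * v i z) $ z))"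
    using insert.hyps by (simp add: vec_eq_iff sum_distrib_right mult_ac)
  also have "\<dots> \<in> vec.span (D (Suc (card K)))"
    using insert.IH by (intro vec.span_sum vec.span_scale mult) (simp_all add: D_def mon_def)
  finally show ?case
    using insert.hyps by (simp add: D_def mon_def)
qed

lemma card_le_of_scalar_product_avoids:
  fixes B :: "('a::{field,finite} ^ 'n::finite) set"
  assumes w: "w \<noteq> 0" and norm: "\<And>x. x \<in> B \<Longrightarrow> scalar_product x x = w"
    and avoid: "\<And>x z. x \<in> B \<Longrightarrow> z \<in> B \<Longrightarrow> x \<noteq> z \<Longrightarrow> scalar_product x z \<notin> {0, w}"
  shows "card B \<le> (CARD('n) + CARD('a) - 2) choose (CARD('a) - 2)"
proof -
  define K where "K = UNIV - {0, w}"
  have card_K: "card K = CARD('a) - 2"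
    using w by (simp add: K_def card_Diff_subset)
  define F :: "'a ^ 'n \<Rightarrow> 'a ^ ('a ^ 'n)" where
    "F = (\<lambda>x. \<chi> z. \<Prod>c\<in>K. scalar_product x z - c)"
  \<comment> \<open>The index \<open>None\<close> stands for an extra coordinate equal to 1, which makes the factors of \<open>F\<close>
    homogeneous linear forms.\<close>
  define v :: "'n option \<Rightarrow> 'a ^ 'n \<Rightarrow> 'a" where
    "v = (\<lambda>i z. case i of None \<Rightarrow> 1 | Some j \<Rightarrow> z $ j)"
  define T where "T = (\<lambda>M. \<chi> z. \<Prod>i\<in>#M. v i z) ` multisets_of_size UNIV (card K)"
  have F_eq: "F x = (\<chi> z. \<Prod>c\<in>K. \<Sum>i\<in>UNIV. (case i of None \<Rightarrow> - c | Some j \<Rightarrow> x $ j) * v i z)" for x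
    by (simp add: F_def v_def scalar_product_def UNIV_option_conv sum.reindex)
  have "F ` B \<subseteq> vec.span T"
    unfolding F_eq T_def by (intro image_subsetI prod_linear_forms_in_span) simp
  \<comment> \<open>On the diagonal every factor is \<open>w - c\<close> with
    \<open>c \<noteq> w\<close>; off it, \<open>scalar_product x z\<close> itself lies in
    \<open>K\<close> and one factor vanishes.\<close>
  moreover have "F x $ x \<noteq> 0" if "x \<in> B" for x
    using norm[OF that] by (simp add: F_def K_def)
  moreover have "F x $ z = 0" if "x \<in> B" "z \<in> B" "x \<noteq> z" for x z
    using avoid[OF that] by (auto simp: F_def K_def)
  moreover have "finite T"
    by simp
  ultimately have "card B \<le> card T"
    by (intro diagonal_card_le_of_span[of B F T])
  also have "\<dots> \<le> card (multisets_of_size (UNIV :: 'n option set) (card K))"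
    unfolding T_def by (intro card_image_le finite_multisets_of_size) simp
  also have "\<dots> = (CARD('n) + CARD('a) - 2) choose (CARD('a) - 2)"
  proof -
    \<comment> \<open>With q = \<open>CARD('a)\<close> and n = \<open>CARD('n)\<close>, the
      multisets of size q - 2 over n + 1 indices number n + (q - 2) choose q - 2. Subtraction
      truncates, so q \<ge> 2 is needed to rewrite n + (q - 2) as n + q - 2.\<close>
    have "card {0, w} \<le> CARD('a)"
      by (intro card_mono) simp_all
    then have "2 \<le> CARD('a)"
      using w by simp
    then show ?thesis
      by (simp add: card_multisets_of_size card_K)
  qed
  finally show ?thesis .
qed

text \<open>Each of the q - 1 nonzero values of the norm contributes a set to which
  \<open>card_le_of_scalar_product_avoids\<close> applies once \<open>y\<close> is moved to the
  origin.\<close>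

lemma card_anisotropic_directions_le:
  fixes A :: "('a::{field,finite} ^ 'n::finite) set"
  assumes A: "\<not> contains_right_angle A" and y: "y \<in> A"
  shows "card {x \<in> A. scalar_product (x - y) (x - y) \<noteq> 0} \<le>
    (CARD('a) - 1) * ((CARD('n) + CARD('a) - 2) choose (CARD('a) - 2))"
    (is "card ?S \<le> _ * ?b")
proof -
  define B where "B = (\<lambda>w. {x \<in> A. scalar_product (x - y) (x - y) = w})"
  have card_B: "card (B w) \<le> ?b" if w: "w \<noteq> 0" for w
  proof -
    have "card ((\<lambda>x. x - y) ` B w) \<le> ?b"
    proof (rule card_le_of_scalar_product_avoids[OF w])
      fix x z
      assume "x \<in> (\<lambda>x. x - y) ` B w" "z \<in> (\<lambda>x. x - y) ` B w" and neq: "x \<noteq> z"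
      then obtain x' z' where x: "x = x' - y" "x' \<in> B w" and z: "z = z' - y" "z' \<in> B w"
        by auto
      \<comment> \<open>A point equal to \<open>y\<close> would give norm 0 instead of
        \<open>w\<close>; so \<open>x'\<close>, \<open>z'\<close>, \<open>y\<close> are distinct, as
        excluding a right angle requires.\<close>
      have "x' \<noteq> y" "z' \<noteq> y"
        using x z w by (auto simp: B_def scalar_product_def)
      with x z neq have "scalar_product (x' - y) (z' - y) \<noteq> 0"
        and z_angle: "scalar_product (x' - z') (y - z') \<noteq> 0"
        using A y unfolding contains_right_angle_def B_def by auto
      \<comment> \<open>The angle at \<open>z'\<close> lies between \<open>x - z\<close> and
        \<open>- z\<close>; as \<open>z\<close> has norm \<open>w\<close>, it would be right exactly
        if \<open>scalar_product x z = w\<close>.\<close>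
      moreover have "scalar_product (x' - z') (y - z') = scalar_product z z - scalar_product x z"
      proof -
        have "x' - z' = x - z" "y - z' = 0 - z"
          by (simp_all add: x z)
        then show ?thesis
          by (simp only: scalar_product_diff_left scalar_product_diff_right)
            (simp add: scalar_product_def)
      qed
      ultimately show "scalar_product x z \<notin> {0, w}"
        using x z by (auto simp: B_def)
    qed (auto simp: B_def)
    then show ?thesis
      by (simp add: card_image inj_on_def)
  qed
  have "card ?S = card (\<Union>w\<in>UNIV - {0}. B w)"
    by (rule arg_cong[where f = card]) (auto simp: B_def)
  also have "\<dots> \<le> (\<Sum>w\<in>UNIV - {0}. card (B w))"
    by (rule card_UN_le) simp
  also have "\<dots> \<le> (\<Sum>w\<in>UNIV - {0::'a}. ?b)"
    by (intro sum_mono card_B) simp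
  also have "\<dots> = (CARD('a) - 1) * ?b"
    by (simp add: card_Diff_subset)
  finally show ?thesis .
qed

theorem theorem1p2:
  fixes q n :: nat and A :: "('a::{field,finite} ^ 'n::finite) set"
  assumes "primepow q" and "odd q" and "n > 0"
    and "CARD('a) = q" and "CARD('n) = n"
    and "\<not> contains_right_angle A"
  shows "card A \<le> 4 * (q - 1) * q * ((n + q - 2) choose (q - 2)) + 2 * q"
proof -
  define aniso where "aniso = (\<lambda>y. {x \<in> A. scalar_product (x - y) (x - y) \<noteq> 0})"
  define m where "m = (q - 1) * ((n + q - 2) choose (q - 2))"
  have aniso_le: "card (aniso y) \<le> m" if "y \<in> A" for y
    using card_anisotropic_directions_le[OF assms(6) that] assms(4,5)
    by (simp add: aniso_def m_def)
  have "(2::'a) \<noteq> 0"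
    using assms by (intro two_neq_zero_if_odd_card) simp
  have "\<exists>y\<in>A. \<exists>y'\<in>A. A \<subseteq> aniso y \<union> aniso y' \<union> {y, y'}" if "A \<noteq> {}"
  proof -
    obtain y where y: "y \<in> A"
      using \<open>A \<noteq> {}\<close> by auto
    show ?thesis
    proof (cases "A \<subseteq> aniso y \<union> {y}")
      \<comment> \<open>One base point suffices here, so \<open>y\<close> also serves as
        \<open>y'\<close>.\<close>
      case True
      with y show ?thesis by blast
    next
      case False
      then obtain y' where y': "y' \<in> A" "y' \<noteq> y" "scalar_product (y' - y) (y' - y) = 0"
        by (auto simp: aniso_def)
      \<comment> \<open>Both \<open>z - y\<close> and \<open>y' - y\<close> have norm 0, so only the
        cross term of the expanded norm of \<open>z - y'\<close> survives.\<close>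
      have "z \<in> aniso y'" if z: "z \<in> A" "z \<notin> aniso y" "z \<noteq> y" "z \<noteq> y'" for z
      proof -
        have "scalar_product (z - y) (y' - y) \<noteq> 0"
          using assms(6) y y' z unfolding contains_right_angle_def by auto
        moreover have "scalar_product (z - y') (z - y') = scalar_product (z - y) (z - y)
            - 2 * scalar_product (z - y) (y' - y) + scalar_product (y' - y) (y' - y)"
        proof -
          define u v where "u = z - y" and "v = y' - y"
          have "z - y' = u - v"
            by (simp add: u_def v_def)
          then have "scalar_product (z - y') (z - y') =
              scalar_product u u - 2 * scalar_product u v + scalar_product v v"
            by (simp add: scalar_product_diff_left scalar_product_diff_right
                scalar_product_commute[of v u])
          then show ?thesis
            by (simp only: u_def v_def)
        qed
        ultimately show ?thesis
          using y' z \<open>2 \<noteq> 0\<close> by (auto simp: aniso_def)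
      qed
      with y y' show ?thesis by blast
    qed
  qed
  \<comment> \<open>The summand 2 pays for the base points, which lie outside their own sets
    \<open>aniso y\<close> and \<open>aniso y'\<close>.\<close>
  then have "card A \<le> 2 * m + 2"
  proof (cases "A = {}")
    case False
    then obtain y y' where "y \<in> A" "y' \<in> A" and sub: "A \<subseteq> aniso y \<union> aniso y' \<union> {y, y'}"
      using \<open>A \<noteq> {} \<Longrightarrow> _\<close> by blast
    have "card A \<le> card (aniso y \<union> aniso y' \<union> {y, y'})"
      using sub by (intro card_mono) simp_all
    also have "\<dots> \<le> card (aniso y) + card (aniso y') + card {y, y'}"
      by (meson card_Un_le add_right_mono order_trans)
    also have "\<dots> \<le> m + m + 2"
      using \<open>y \<in> A\<close> \<open>y' \<in> A\<close> by (intro add_mono aniso_le) (simp_all add: card_insert_if)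
    finally show ?thesis by simp
  qed simp
  \<comment> \<open>As \<open>q \<ge> 1\<close>, the bound \<open>2 * m + 2\<close> implies the
    weaker \<open>4 * (m * q) + 2 * q\<close>.\<close>
  moreover have "q \<ge> 1"
    using \<open>odd q\<close> by (cases q) auto
  moreover have "m \<le> m * q"
    using \<open>q \<ge> 1\<close> by simp
  ultimately have "card A \<le> 4 * (m * q) + 2 * q"
    by linarith
  then show ?thesis
    by (simp add: m_def mult_ac)
qed

end
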